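(* Every graph $G$ with maximum degree at most $5$ has an acyclic $\mathcal{D}_1^{(5)}$-colouring, i.e. a colouring $c:V(G)\to\{1,\dots,5\}$ such that each colour class induces a forest and for every two distinct colours $i,j$ the subgraph consisting of all edges joining a vertex of colour $i$ to a vertex of colour $j$ is acyclic.
   Context: All graphs are finite and simple. Colourings are not required to be proper. $\mathcal{D}_1$ denotes the class of acyclic graphs (forests). *)

theory Defs
  imports Main
begin

definition simple_graph :: "'a set \<Rightarrow> 'a set set \<Rightarrow> bool" where
  "simple_graph V E \<longleftrightarrow> finite V \<and> (\<forall>e\<in>E. e \<subseteq> V \<and> card e = 2)"

definition degree :: "'a set set \<Rightarrow> 'a \<Rightarrow> nat" where
  "degree E v = card {e \<in> E. v \<in> e}"

definition is_cycle :: "'a set set \<Rightarrow> 'a list \<Rightarrow> bool" where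
  "is_cycle E vs \<longleftrightarrow> length vs \<ge> 3 \<and> distinct vs \<and>
     (\<forall>i < length vs. {vs ! i, vs ! ((i + 1) mod length vs)} \<in> E)"

text \<open>Acyclic graph (forest): no cycle.  Membership of vertices in V is implied by edges.\<close>
definition acyclic_graph :: "'a set set \<Rightarrow> bool" where
  "acyclic_graph E \<longleftrightarrow> \<not> (\<exists>vs. is_cycle E vs)"

definition induced_edges :: "'a set set \<Rightarrow> 'a set \<Rightarrow> 'a set set" where
  "induced_edges E S = {e \<in> E. e \<subseteq> S}"

definition bichromatic_edges :: "'a set set \<Rightarrow> ('a \<Rightarrow> nat) \<Rightarrow> nat \<Rightarrow> nat \<Rightarrow> 'a set set" where
  "bichromatic_edges E c i j = {e \<in> E. \<exists>u v. e = {u, v} \<and> c u = i \<and> c v = j}"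

definition acyclic_D1_colouring :: "'a set \<Rightarrow> 'a set set \<Rightarrow> nat \<Rightarrow> ('a \<Rightarrow> nat) \<Rightarrow> bool" where
  "acyclic_D1_colouring V E k c \<longleftrightarrow>
     (\<forall>v\<in>V. c v \<in> {1..k}) \<and>
     (\<forall>i\<in>{1..k}. acyclic_graph (induced_edges E {v \<in> V. c v = i})) \<and>
     (\<forall>i\<in>{1..k}. \<forall>j\<in>{1..k}. i \<noteq> j \<longrightarrow> acyclic_graph (bichromatic_edges E c i j))"

end

(* Colour the vertices one at a time; when h is the only uncoloured vertex, a colour i can fail at h
   only if two equally coloured neighbours of h both see i. A neighbour of h sees at most four colours,
   it can be recoloured at will when it sees four distinct ones, and the hole can be moved from h to
   a neighbour. Counting then excludes every distribution of colours around h except the patterns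
   2+2+1, 3+2 and 5. In the pattern 2+2+1 the two pairs see T + r and T' + r with T and T' meeting
   only in r. Moving the hole shows that either pair may give one of its members the colour of the
   fifth neighbour, which then forms a new pair and would have to see both multisets. The patterns
   3+2 and 5 are brought back to excluded ones by counting and moving the hole. *)
theory Submission
  imports Defs
begin

subsection \<open>Extending a colouring to one more vertex\<close>

text \<open>Each of the five colours must be seen by two neighbours of the hole, so ten incidences
  between neighbours and seen colours are required. This is the 10 that 3 * 3 and 4 * 2 miss; the
  patterns 3+2 and 5 can reach it, and there the structure forced by equality takes over. The
  obstacle is that recolouring a neighbour of the hole may change what the other neighbours see.
  Hence the arguments keep track of which neighbours of the hole agree in colour and derive anew
  what they see after each change. No quantity decreases when the hole moves: the graph is fixed,
  and a pattern once excluded is excluded at every hole of every colouring, so it is enough to reach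
  one.\<close>

definition nbrs :: "'a set set \<Rightarrow> 'a \<Rightarrow> 'a set" where
  "nbrs E u = {w. {u, w} \<in> E}"

text \<open>The case \<open>i = j\<close> is included, so cycles inside one class and cycles between
  two classes fall under one condition.\<close>

definition valid :: "'a set set \<Rightarrow> ('a \<Rightarrow> nat) \<Rightarrow> bool" where
  "valid E c \<longleftrightarrow> (\<forall>i j. acyclic_graph (bichromatic_edges E c i j))"

lemma nbrs_sym: "y \<in> nbrs E x \<longleftrightarrow> x \<in> nbrs E y"
  by (simp add: nbrs_def insert_commute)

lemma valid_mono:
  assumes "valid E c" "F \<subseteq> E" shows "valid F c"
  using assms unfolding valid_def acyclic_graph_def is_cycle_def bichromatic_edges_def by blast

lemma mem_bichromatic_iff:
  "{x, y} \<in> bichromatic_edges E c i j \<longleftrightarrow>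
    {x, y} \<in> E \<and> (c x = i \<and> c y = j \<or> c x = j \<and> c y = i)"
  unfolding bichromatic_edges_def by (auto simp: doubleton_eq_iff)

text \<open>In a triangle \<open>y'\<close> is \<open>z\<close> and \<open>z'\<close> is
  \<open>y\<close>, in a 4-cycle \<open>y'\<close> is \<open>z'\<close>; the conclusion leaves these
  coincidences open, so short cycles need no separate treatment.\<close>

lemma cycle_through_vertex:
  assumes "is_cycle E vs" "u \<in> set vs"
  obtains y y' z z' where "y \<noteq> z" "y' \<noteq> u" "z' \<noteq> u"
    "{u, y} \<in> E" "{u, z} \<in> E" "{y, y'} \<in> E" "{z, z'} \<in> E"
proof -
  define n where "n = length vs"
  define s where "s k = (if k + 1 = n then 0 else k + 1)" for k
  define p where "p k = (if k = 0 then n - 1 else k - 1)" for k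
  have n: "n \<ge> 3" and d: "distinct vs"
    and e: "\<And>k. k < n \<Longrightarrow> {vs ! k, vs ! ((k + 1) mod n)} \<in> E"
    using assms(1) by (auto simp: is_cycle_def n_def)
  have e': "{vs ! k, vs ! s k} \<in> E" if "k < n" for k
  proof (cases "k + 1 = n")
    case True then show ?thesis using e[OF that] by (simp add: s_def)
  next
    case False then show ?thesis using e[OF that] that by (simp add: s_def)
  qed
  obtain k where k: "k < n" "u = vs ! k"
    using assms(2) by (metis in_set_conv_nth n_def)
  have lt: "s j < n" "p j < n" "s (p j) = j" if "j < n" for j
    using that n by (auto simp: s_def p_def)
  have ne: "s k \<noteq> p k" "s (s k) \<noteq> k" "p (p k) \<noteq> k"
    using k(1) n by (auto simp: s_def p_def split: if_splits)
  have inj: "vs ! i \<noteq> vs ! j" if "i < n" "j < n" "i \<noteq> j" for i j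
    using that d by (simp add: n_def nth_eq_iff_index_eq)
  have "{u, vs ! p k} \<in> E" "{vs ! p k, vs ! p (p k)} \<in> E"
    using e'[of "p k"] e'[of "p (p k)"] lt k by (simp_all add: insert_commute)
  moreover have "{u, vs ! s k} \<in> E" "{vs ! s k, vs ! s (s k)} \<in> E"
    using e' lt k by simp_all
  ultimately show ?thesis
    using that[of "vs ! s k" "vs ! p k" "vs ! s (s k)" "vs ! p (p k)"] inj lt ne k by metis
qed

text \<open>A bad cycle through \<open>u\<close> enters and leaves \<open>u\<close> through two neighbours of equal colour, and its
  vertices at distance two along the cycle have the colour of \<open>u\<close>. Hence the condition below, which
  ignores whether the two neighbours are actually joined by a path, already rules it out.\<close>
lemma valid_extend:
  assumes val: "valid {e \<in> E. u \<notin> e} c"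
    and nb: "\<And>y z. \<lbrakk>y \<in> nbrs E u; z \<in> nbrs E u; y \<noteq> z; c y = c z;
      i \<in> c ` (nbrs E y - {u}); i \<in> c ` (nbrs E z - {u})\<rbrakk> \<Longrightarrow> False"
    and loop: "{u} \<notin> E"
  shows "valid E (c(u := i))"
  unfolding valid_def acyclic_graph_def
proof (intro allI notI, elim exE)
  fix j k vs
  let ?c = "c(u := i)"
  assume cyc: "is_cycle (bichromatic_edges E ?c j k) vs"
  show False
  proof (cases "u \<in> set vs")
    case False
    have "is_cycle (bichromatic_edges {e \<in> E. u \<notin> e} c j k) vs"
      unfolding is_cycle_def
    proof (intro conjI allI impI)
      show "3 \<le> length vs" "distinct vs" using cyc by (auto simp: is_cycle_def)
      fix m assume m: "m < length vs"
      let ?x = "vs ! m" and ?y = "vs ! ((m + 1) mod length vs)"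
      have "(m + 1) mod length vs < length vs" using m by (intro mod_less_divisor) linarith
      then have "?x \<noteq> u" "?y \<noteq> u" using False m by (metis nth_mem)+
      moreover have "{?x, ?y} \<in> bichromatic_edges E ?c j k"
        using cyc m by (simp add: is_cycle_def)
      ultimately show "{?x, ?y} \<in> bichromatic_edges {e \<in> E. u \<notin> e} c j k"
        unfolding mem_bichromatic_iff by auto
    qed
    then show False using val by (auto simp: valid_def acyclic_graph_def)
  next
    case True
    obtain y y' z z' where a: "y \<noteq> z" "y' \<noteq> u" "z' \<noteq> u"
      "{u, y} \<in> bichromatic_edges E ?c j k" "{u, z} \<in> bichromatic_edges E ?c j k"
      "{y, y'} \<in> bichromatic_edges E ?c j k" "{z, z'} \<in> bichromatic_edges E ?c j k"
      using cycle_through_vertex[OF cyc True] .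
    have ne: "y \<noteq> u" "z \<noteq> u" using a(4,5) loop by (auto simp: mem_bichromatic_iff)
    have m: "y \<in> nbrs E u" "z \<in> nbrs E u" "y' \<in> nbrs E y" "z' \<in> nbrs E z"
      using a by (auto simp: mem_bichromatic_iff nbrs_def)
    have eq: "c y = c z" "c y' = i" "c z' = i"
      using a ne unfolding mem_bichromatic_iff by (auto split: if_splits)
    have "i \<in> c ` (nbrs E y - {u})" "i \<in> c ` (nbrs E z - {u})"
      using m(3,4) a(2,3) imageI[of y' "nbrs E y - {u}" c] imageI[of z' "nbrs E z - {u}" c] eq by auto
    from nb[OF m(1,2) a(1) eq(1) this] show False .
  qed
qed

text \<open>Counts the pairs \<open>(a, i)\<close> with \<open>i\<close> in \<open>C a\<close>; each
  \<open>i\<close> in \<open>L\<close> contributes at least two.\<close>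

lemma double_count:
  assumes "finite A" "finite L"
    and two: "\<And>i. i \<in> L \<Longrightarrow> \<exists>a\<in>A. \<exists>b\<in>A. a \<noteq> b \<and> i \<in> C a \<and> i \<in> C b"
  shows "2 * card L \<le> (\<Sum>a\<in>A. card (C a \<inter> L))"
proof -
  have "2 \<le> card {a \<in> A. i \<in> C a}" if i: "i \<in> L" for i
  proof -
    obtain a b where ab: "a \<in> A" "b \<in> A" "a \<noteq> b" "i \<in> C a" "i \<in> C b" using two[OF i] by blast
    then have "card {a, b} \<le> card {a \<in> A. i \<in> C a}" using assms(1) by (intro card_mono) auto
    then show ?thesis using ab by simp
  qed
  then have "(\<Sum>i\<in>L. 2) \<le> (\<Sum>i\<in>L. card {a \<in> A. i \<in> C a})" by (intro sum_mono) auto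
  also have "\<dots> = (\<Sum>i\<in>L. \<Sum>a\<in>A. if i \<in> C a then 1 else 0)"
    using assms(1) by (simp add: sum.If_cases Int_def)
  also have "\<dots> = (\<Sum>a\<in>A. \<Sum>i\<in>L. if i \<in> C a then 1 else 0)" by (rule sum.swap)
  also have "\<dots> = (\<Sum>a\<in>A. card (C a \<inter> L))"
    using assms(2) by (simp add: sum.If_cases Int_def conj_commute)
  finally show ?thesis by simp
qed

text \<open>Dropping \<open>x\<close> or \<open>y\<close> keeps all three values on at most three
  elements, so \<open>f\<close> is injective on the rest. Every coincidence must therefore use both
  \<open>x\<close> and \<open>y\<close>.\<close>

lemma one_repetition:
  fixes f :: "'b \<Rightarrow> nat"
  assumes "finite D" "card D \<le> 4" "card (f ` D) = 3" "x \<in> D" "y \<in> D" "x \<noteq> y" "f x = f y"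
    "v \<in> D" "w \<in> D" "v \<noteq> w" "f v = f w"
  shows "{v, w} = {x, y}"
proof -
  have *: "inj_on f (D - {a})" if "a \<in> {x, y}" for a
  proof (rule eq_card_imp_inj_on)
    define b where "b = (if a = x then y else x)"
    have b: "b \<in> D" "b \<noteq> a" "f b = f a" "a \<in> D"
      using that assms(4-7) by (auto simp: b_def)
    then have "f ` D = insert (f a) (f ` (D - {a}))" "f a \<in> f ` (D - {a})"
      by (auto intro: rev_image_eqI[of b])
    then have "f ` (D - {a}) = f ` D" by auto
    moreover have "card (D - {a}) \<le> 3" using b(4) assms(1,2) by simp
    ultimately show "card (f ` (D - {a})) = card (D - {a})"
      using card_image_le[of "D - {a}" f] assms(1,3) by simp
  qed (use assms in auto)
  have "x \<in> {v, w}"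
    using inj_onD[OF *[of x] assms(11)] assms(8-10) by auto
  moreover have "y \<in> {v, w}"
    using inj_onD[OF *[of y] assms(11)] assms(8-10) by auto
  ultimately show ?thesis using assms(6,10) by auto
qed

lemma three_colours:
  fixes f :: "'b \<Rightarrow> nat"
  assumes "finite D" "card D \<le> 4" "card (f ` D) = 3" "\<not> inj_on f D"
  obtains x y where "x \<in> D" "y \<in> D" "x \<noteq> y" "f x = f y"
    "\<And>v w. \<lbrakk>v \<in> D; w \<in> D; v \<noteq> w; f v = f w\<rbrakk> \<Longrightarrow> {v, w} = {x, y}"
    "card D = 4"
proof -
  obtain x y where xy: "x \<in> D" "y \<in> D" "x \<noteq> y" "f x = f y"
    using assms(4) by (auto simp: inj_on_def)
  have "card D \<noteq> 3" using assms(1,3,4) eq_card_imp_inj_on[of D f] by auto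
  moreover have "card D \<ge> 3" using card_image_le[of D f] assms(1,3) by simp
  ultimately have "card D = 4" using assms(2) by simp
  then show ?thesis using that xy one_repetition[OF assms(1-3) xy] by metis
qed

subsection \<open>Colourings with a hole\<close>

locale uncolourable =
  fixes E :: "'a set set" and N :: "'a \<Rightarrow> 'a set" and K :: "nat set"
  defines "N \<equiv> nbrs E" and "K \<equiv> {1..5}"
  assumes loopless: "{u} \<notin> E"
    and finite_N: "finite (N u)"
    and card_N: "card (N u) \<le> 5"
    and no_colouring: "\<lbrakk>range c \<subseteq> K; valid E c\<rbrakk> \<Longrightarrow> False"
begin

lemma N_irrefl: "u \<notin> N u"
  using loopless[of u] by (simp add: N_def nbrs_def)

lemma N_sym: "y \<in> N x \<longleftrightarrow> x \<in> N y"
  by (simp add: N_def nbrs_sym)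

lemma K: "finite K" "card K = 5"
  by (simp_all add: K_def)

text \<open>The value of \<open>c\<close> at the uncoloured vertex \<open>h\<close> is irrelevant.\<close>
definition hole :: "'a \<Rightarrow> ('a \<Rightarrow> nat) \<Rightarrow> bool" where
  "hole h c \<longleftrightarrow> range c \<subseteq> K \<and> valid {e \<in> E. h \<notin> e} c"

definition cols :: "'a \<Rightarrow> ('a \<Rightarrow> nat) \<Rightarrow> 'a \<Rightarrow> nat set" where
  "cols h c a = c ` (N a - {h})"

text \<open>Neighbours of \<open>h\<close> outside \<open>A\<close> have colours that occur once
  around \<open>h\<close>. As \<open>cols\<close> is not mentioned, the condition can be maintained
  while a recolouring disturbs what the neighbours see.\<close>

definition pairs_in :: "'a \<Rightarrow> ('a \<Rightarrow> nat) \<Rightarrow> 'a set \<Rightarrow> bool" where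
  "pairs_in h c A \<longleftrightarrow> (\<forall>y\<in>N h. \<forall>z\<in>N h. y \<noteq> z \<longrightarrow> c y = c z \<longrightarrow> y \<in> A \<and> z \<in> A)"

lemma hole_range: "hole h c \<Longrightarrow> c x \<in> K"
  by (auto simp: hole_def)

lemma cols_subset: "hole h c \<Longrightarrow> cols h c a \<subseteq> K"
  by (auto simp: cols_def dest: hole_range)

lemma finite_cols: "finite (cols h c a)"
  by (simp add: cols_def finite_N)

lemma hole_blocked:
  assumes "hole h c" "i \<in> K"
  shows "\<exists>y\<in>N h. \<exists>z\<in>N h. y \<noteq> z \<and> c y = c z \<and> i \<in> cols h c y \<and> i \<in> cols h c z"
proof (rule ccontr)
  assume *: "\<not> ?thesis"
  have "valid E (c(h := i))"
    using assms(1) * by (intro valid_extend) (auto simp: hole_def loopless cols_def N_def)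
  moreover have "range (c(h := i)) \<subseteq> K" using assms by (auto simp: hole_def)
  ultimately show False using no_colouring by blast
qed

lemma nbrs_del: "u \<noteq> h \<Longrightarrow> nbrs {e \<in> E. h \<notin> e} u = N u - {h}"
  by (auto simp: nbrs_def N_def)

lemma hole_recolour:
  assumes "hole h c" "u \<noteq> h" "i \<in> K"
    and nb: "\<And>y z. \<lbrakk>y \<in> N u - {h}; z \<in> N u - {h}; y \<noteq> z; c y = c z;
      i \<in> c ` (N y - {h, u}); i \<in> c ` (N z - {h, u})\<rbrakk> \<Longrightarrow> False"
  shows "hole h (c(u := i))"
proof -
  have "valid {e \<in> E. h \<notin> e} (c(u := i))"
  proof (rule valid_extend)
    show "valid {e \<in> {e \<in> E. h \<notin> e}. u \<notin> e} c"
      using assms(1) by (auto simp: hole_def intro: valid_mono)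
    show "{u} \<notin> {e \<in> E. h \<notin> e}" using loopless by auto
  next
    fix y z
    let ?F = "{e \<in> E. h \<notin> e}"
    assume a: "y \<in> nbrs ?F u" "z \<in> nbrs ?F u" "y \<noteq> z" "c y = c z"
      "i \<in> c ` (nbrs ?F y - {u})" "i \<in> c ` (nbrs ?F z - {u})"
    have ne: "y \<noteq> h" "z \<noteq> h" using a by (auto simp: nbrs_def)
    have "y \<in> N u - {h}" "z \<in> N u - {h}" using a(1,2) assms(2) by (simp_all add: nbrs_del)
    moreover have "i \<in> c ` (N y - {h, u})" "i \<in> c ` (N z - {h, u})"
      using a(5,6) unfolding nbrs_del[OF ne(1)] nbrs_del[OF ne(2)] Diff_insert2[of _ h "{u}"] .
    ultimately show False using nb a(3,4) by metis
  qed
  then show ?thesis using assms by (auto simp: hole_def)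
qed

lemma hole_move:
  assumes "hole h c" "a \<in> N h" "i \<in> K"
    and nb: "\<And>y z. \<lbrakk>y \<in> N h - {a}; z \<in> N h - {a}; y \<noteq> z; c y = c z;
      i \<in> cols h c y; i \<in> cols h c z\<rbrakk> \<Longrightarrow> False"
  shows "hole a (c(h := i))"
proof -
  have ne: "h \<noteq> a" using assms(2) N_irrefl by blast
  have "valid {e \<in> E. a \<notin> e} (c(h := i))"
  proof (rule valid_extend)
    show "valid {e \<in> {e \<in> E. a \<notin> e}. h \<notin> e} c"
      using assms(1) by (auto simp: hole_def intro: valid_mono)
    show "{h} \<notin> {e \<in> E. a \<notin> e}" using loopless by auto
  next
    fix y z
    let ?F = "{e \<in> E. a \<notin> e}"
    assume b: "y \<in> nbrs ?F h" "z \<in> nbrs ?F h" "y \<noteq> z" "c y = c z"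
      "i \<in> c ` (nbrs ?F y - {h})" "i \<in> c ` (nbrs ?F z - {h})"
    have "y \<noteq> a" "z \<noteq> a" using b by (auto simp: nbrs_def)
    then show False using nb[of y z] b ne by (auto simp: nbrs_del cols_def)
  qed
  then show ?thesis using assms by (auto simp: hole_def)
qed

lemma card_N_minus: "a \<in> N h \<Longrightarrow> card (N a - {h}) \<le> 4"
  using card_N[of a] N_sym[of a h] finite_N[of a] by (simp add: card_Diff_singleton)

lemma rainbow_if_card_cols:
  assumes "a \<in> N h" "card (cols h c a) \<ge> card (N a - {h})"
  shows "inj_on c (N a - {h})"
  using assms card_image_le[of "N a - {h}" c] finite_N
  by (intro eq_card_imp_inj_on) (auto simp: cols_def intro: le_antisym)

lemma card_cols_if_not_rainbow:
  assumes "a \<in> N h" "\<not> inj_on c (N a - {h})"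
  shows "card (cols h c a) \<le> 3"
proof (rule ccontr)
  assume "\<not> ?thesis"
  then have "card (N a - {h}) \<le> card (cols h c a)" using card_N_minus[OF assms(1)] by linarith
  then show False using rainbow_if_card_cols assms by blast
qed

lemma three_cols_if_not_rainbow:
  assumes "a \<in> N h" "card (cols h c a) = 3" "\<not> inj_on c (N a - {h})"
  shows "\<exists>x\<in>N a - {h}. \<exists>y\<in>N a - {h}. x \<noteq> y \<and> c x = c y \<and> card (N a - {h}) = 4 \<and>
    (\<forall>v\<in>N a - {h}. \<forall>w\<in>N a - {h}. v \<noteq> w \<longrightarrow> c v = c w \<longrightarrow> {v, w} = {x, y})"
proof -
  have "finite (N a - {h})" using finite_N by simp
  from three_colours[OF this card_N_minus[OF assms(1)] assms(2)[unfolded cols_def] assms(3)]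
  show ?thesis by (smt (verit))
qed

text \<open>No two neighbours of \<open>a\<close> other than \<open>h\<close> agree, so nothing
  obstructs recolouring \<open>a\<close>, and the at most four other neighbours of \<open>h\<close>
  leave one of the five colours for it.\<close>

lemma isolate:
  assumes "hole h c" "a \<in> N h" "inj_on c (N a - {h})"
  shows "\<exists>c'. hole h c' \<and> (\<forall>b\<in>N h - {a}. c' b = c b \<and> c' b \<noteq> c' a)"
proof -
  have "card (c ` (N h - {a})) \<le> 4"
    using card_image_le[of "N h - {a}" c] card_N_minus[of h a] assms(2) N_sym finite_N
    by (meson finite_Diff le_trans)
  then have "\<not> K \<subseteq> c ` (N h - {a})"
    using card_mono[of "c ` (N h - {a})" K] K finite_N by fastforce
  then obtain i where i: "i \<in> K" "i \<notin> c ` (N h - {a})" by blast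
  have "hole h (c(a := i))"
    using assms i(1) N_irrefl by (intro hole_recolour) (auto dest: inj_onD)
  then show ?thesis using i(2) by (intro exI[of _ "c(a := i)"]) auto
qed

lemma isolate_pairs_in:
  assumes "hole h c" "a \<in> N h" "inj_on c (N a - {h})" "pairs_in h c A"
  shows "\<exists>c'. hole h c' \<and> pairs_in h c' (A - {a})"
proof -
  obtain c' where c': "hole h c'" "\<forall>b\<in>N h - {a}. c' b = c b \<and> c' b \<noteq> c' a"
    using isolate[OF assms(1-3)] by blast
  have "pairs_in h c' (A - {a})"
    unfolding pairs_in_def
  proof (intro ballI impI)
    fix y z assume yz: "y \<in> N h" "z \<in> N h" "y \<noteq> z" "c' y = c' z"
    then have "y \<noteq> a" "z \<noteq> a" using c'(2) by (metis Diff_iff singletonD)+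
    then show "y \<in> A - {a} \<and> z \<in> A - {a}" using yz c'(2) assms(4) by (auto simp: pairs_in_def)
  qed
  then show ?thesis using c'(1) by blast
qed

lemma cols_count:
  assumes "finite A" "\<And>i. i \<in> K \<Longrightarrow> \<exists>y\<in>A. \<exists>z\<in>A. y \<noteq> z \<and> i \<in> cols h c y \<and> i \<in> cols h c z"
    and "\<And>a. a \<in> A \<Longrightarrow> card (cols h c a) \<le> m"
  shows "10 \<le> card A * m"
proof -
  have "2 * card K \<le> (\<Sum>a\<in>A. card (cols h c a \<inter> K))"
    using assms(1,2) K by (intro double_count) auto
  also have "\<dots> \<le> (\<Sum>a\<in>A. m)"
    by (intro sum_mono order.trans[OF card_mono assms(3)]) (auto simp: finite_cols)
  finally show ?thesis by (simp add: K)
qed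

lemma pairs_in_blocked:
  assumes "hole h c" "pairs_in h c A" "i \<in> K"
  shows "\<exists>y\<in>A. \<exists>z\<in>A. y \<noteq> z \<and> i \<in> cols h c y \<and> i \<in> cols h c z"
  using hole_blocked[OF assms(1,3)] assms(2) unfolding pairs_in_def by meson

text \<open>Three vertices seeing at most three colours each give 9 incidences, fewer than 10. A
  vertex whose seen colours are all distinct is isolated instead; this shrinks \<open>A\<close> but
  may alter what the others see, hence the induction over all colourings.\<close>

lemma no_pairs_in_three:
  assumes "hole h c" "finite A" "card A \<le> 3" "A \<subseteq> N h" "pairs_in h c A"
  shows False
  using assms
proof (induction "card A" arbitrary: A c rule: less_induct)
  case less
  show False
  proof (cases "\<exists>a\<in>A. inj_on c (N a - {h})")
    case True
    then obtain a where a: "a \<in> A" "inj_on c (N a - {h})" by blast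
    then obtain c' where "hole h c'" "pairs_in h c' (A - {a})"
      using isolate_pairs_in less.prems by blast
    moreover have "card (A - {a}) < card A" using a(1) less.prems(2) by (rule card_Diff1_less[rotated])
    ultimately show False using less.hyps[of "A - {a}" c'] less.prems by auto
  next
    case False
    then have "card (cols h c a) \<le> 3" if "a \<in> A" for a
      using card_cols_if_not_rainbow less.prems(4) that by blast
    then have "10 \<le> card A * 3"
      using cols_count[of A h c 3] pairs_in_blocked less.prems by blast
    then show False using less.prems(3) by simp
  qed
qed

subsection \<open>Two pairs of equally coloured neighbours\<close>

text \<open>The fifth neighbour is not named, since \<open>h\<close> might have only four; its
  existence is derived in \<open>two_pairs_fifth\<close>.\<close>

definition two_pairs :: "'a \<Rightarrow> ('a \<Rightarrow> nat) \<Rightarrow> 'a \<Rightarrow> 'a \<Rightarrow> 'a \<Rightarrow> 'a \<Rightarrow> bool" where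
  "two_pairs h c a b p d \<longleftrightarrow>
    {a, b, p, d} \<subseteq> N h \<and> a \<noteq> b \<and> p \<noteq> d \<and> c a = c b \<and> c p = c d \<and> c a \<noteq> c p \<and>
    (\<forall>y\<in>N h. \<forall>z\<in>N h. y \<noteq> z \<longrightarrow> c y = c z \<longrightarrow> {y, z} = {a, b} \<or> {y, z} = {p, d})"

text \<open>The degree clause will be applied to \<open>h\<close> after the hole has moved to
  \<open>a\<close>, where it yields a fifth neighbour of \<open>h\<close>.\<close>

definition repeats :: "'a \<Rightarrow> ('a \<Rightarrow> nat) \<Rightarrow> 'a \<Rightarrow> nat \<Rightarrow> nat set \<Rightarrow> bool" where
  "repeats h c a r T \<longleftrightarrow> card (N a - {h}) = 4 \<and> cols h c a = T \<and>
    (\<forall>v\<in>N a - {h}. \<forall>w\<in>N a - {h}. v \<noteq> w \<longrightarrow> c v = c w \<longrightarrow> c v = r)"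

lemma two_pairs_swap: "two_pairs h c a b p d \<Longrightarrow> two_pairs h c p d a b"
  unfolding two_pairs_def by (elim conjE, intro conjI) (auto)

lemma two_pairs_flip: "two_pairs h c a b p d \<Longrightarrow> two_pairs h c b a p d"
  unfolding two_pairs_def by (elim conjE, intro conjI) (simp_all add: insert_commute)

lemma two_pairsD:
  assumes "two_pairs h c a b p d" "v \<in> N h" "w \<in> N h" "v \<noteq> w" "c v = c w"
  shows "{v, w} = {a, b} \<or> {v, w} = {p, d}"
proof -
  have "\<forall>y\<in>N h. \<forall>z\<in>N h. y \<noteq> z \<longrightarrow> c y = c z \<longrightarrow> {y, z} = {a, b} \<or> {y, z} = {p, d}"
    using assms(1) unfolding two_pairs_def by (elim conjE)
  from this[rule_format, OF assms(2-5)] show ?thesis .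
qed

lemma two_pairs_avoid:
  assumes "two_pairs h c a b p d" "v \<in> N h - {a}" "w \<in> N h - {a}" "v \<noteq> w" "c v = c w"
  shows "{v, w} = {p, d}"
proof -
  have "{v, w} = {a, b} \<or> {v, w} = {p, d}" 
    using two_pairsD[OF assms(1) _ _ assms(4,5)] assms(2,3) by blast
  moreover have "a \<notin> {v, w}" using assms(2,3) by blast
  ultimately show ?thesis by (metis insertI1)
qed

lemma two_pairs_not_rainbow:
  assumes "hole h c" "two_pairs h c a b p d"
  shows "\<not> inj_on c (N a - {h})"
proof
  assume inj: "inj_on c (N a - {h})"
  have a: "a \<in> N h" "{b, p, d} \<subseteq> N h" using assms(2) by (simp_all add: two_pairs_def)
  have pairs: "pairs_in h c {a, b, p, d}"
    unfolding pairs_in_def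
  proof (intro ballI impI)
    fix y z assume "y \<in> N h" "z \<in> N h" "y \<noteq> z" "c y = c z"
    then show "y \<in> {a, b, p, d} \<and> z \<in> {a, b, p, d}" using two_pairsD[OF assms(2), of y z] by auto
  qed
  obtain c' where c': "hole h c'" "pairs_in h c' ({a, b, p, d} - {a})"
    using isolate_pairs_in[OF assms(1) a(1) inj pairs] by blast
  have "card ({a, b, p, d} - {a}) \<le> card {b, p, d}" by (intro card_mono) auto
  also have "\<dots> \<le> 3" by (simp add: card_insert_if)
  finally show False using no_pairs_in_three[OF c'(1) _ _ _ c'(2)] a(2) by auto
qed

lemma two_pairs_card_cols:
  assumes "hole h c" "two_pairs h c a b p d"
  shows "card (cols h c a) \<le> 3"
  using card_cols_if_not_rainbow[OF _ two_pairs_not_rainbow[OF assms]] assms(2)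
  by (simp add: two_pairs_def)

text \<open>Let \<open>x\<close>, \<open>y\<close> be the agreeing neighbours of \<open>a\<close>.
  If \<open>p\<close> or \<open>d\<close> missed their colour, \<open>h\<close> could take it and
  the hole could move to \<open>a\<close>, where only \<open>h\<close>, \<open>x\<close>,
  \<open>y\<close> would agree.\<close>

lemma two_pairs_repeats:
  assumes hole: "hole h c" and pat: "two_pairs h c a b p d" and c3: "card (cols h c a) = 3"
  shows "\<exists>r. r \<in> cols h c a \<and> r \<in> cols h c p \<and> r \<in> cols h c d \<and> repeats h c a r (cols h c a)"
proof -
  have a: "a \<in> N h" using pat by (simp add: two_pairs_def)
  obtain x y where x: "x \<in> N a - {h}" "y \<in> N a - {h}" "x \<noteq> y" "c x = c y"
    and xy0: "\<forall>v\<in>N a - {h}. \<forall>w\<in>N a - {h}. v \<noteq> w \<longrightarrow> c v = c w \<longrightarrow> {v, w} = {x, y}"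
    and c4: "card (N a - {h}) = 4"
    using three_cols_if_not_rainbow[OF a c3 two_pairs_not_rainbow[OF hole pat]]
    by (elim bexE conjE) (rule that)
  have xy: "{v, w} = {x, y}" if "v \<in> N a - {h}" "w \<in> N a - {h}" "v \<noteq> w" "c v = c w" for v w
    using xy0 that by blast
  have rep: "repeats h c a (c x) (cols h c a)"
    unfolding repeats_def
  proof (intro conjI ballI impI)
    fix v w assume "v \<in> N a - {h}" "w \<in> N a - {h}" "v \<noteq> w" "c v = c w"
    then have "v \<in> {x, y}" using xy[of v w] by auto
    then show "c v = c x" using x by auto
  qed (use c4 in auto)
  have "c x \<in> cols h c p \<and> c x \<in> cols h c d"
  proof (rule ccontr)
    assume n: "\<not> ?thesis"
    have h: "hole a (c(h := c x))"
    proof (rule hole_move[OF hole a hole_range[OF hole]])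
      fix v w assume v: "v \<in> N h - {a}" "w \<in> N h - {a}" "v \<noteq> w" "c v = c w"
        "c x \<in> cols h c v" "c x \<in> cols h c w"
      then have "{v, w} = {p, d}" using two_pairs_avoid[OF pat] by simp
      then show False using n v(5,6) by (auto simp: doubleton_eq_iff)
    qed
    have "pairs_in a (c(h := c x)) {h, x, y}"
      unfolding pairs_in_def
    proof (intro ballI impI)
      fix v w assume v: "v \<in> N a" "w \<in> N a" "v \<noteq> w" "(c(h := c x)) v = (c(h := c x)) w"
      consider "v = h" | "w = h" | "v \<noteq> h" "w \<noteq> h" by blast
      then show "v \<in> {h, x, y} \<and> w \<in> {h, x, y}"
      proof cases
        case 1
        then have "w = x \<or> {w, x} = {x, y}" using v x xy[of w x] by auto
        then show ?thesis using 1 by auto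
      next
        case 2
        then have "v = x \<or> {v, x} = {x, y}" using v x xy[of v x] by auto
        then show ?thesis using 2 by auto
      next
        case 3
        then show ?thesis using v xy[of v w] by auto
      qed
    qed
    moreover have "{h, x, y} \<subseteq> N a" using x a N_sym by auto
    moreover have "card {h, x, y} \<le> 3" by (simp add: card_insert_if)
    ultimately show False using no_pairs_in_three[OF h, of "{h, x, y}"] by simp
  qed
  moreover have "c x \<in> cols h c a" using x by (auto simp: cols_def)
  ultimately show ?thesis using rep by blast
qed

text \<open>When \<open>T\<close> has three elements, \<open>repeats h c a r T\<close> says that \<open>a\<close> sees the colours of \<open>T\<close>, each
  once except for \<open>r\<close>, which it sees twice.\<close>
definition rigid :: "'a \<Rightarrow> ('a \<Rightarrow> nat) \<Rightarrow> 'a \<Rightarrow> 'a \<Rightarrow> 'a \<Rightarrow> 'a \<Rightarrow> nat \<Rightarrow> nat set \<Rightarrow> nat set \<Rightarrow> bool" where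
  "rigid h c a b p d r T T' \<longleftrightarrow>
    repeats h c a r T \<and> repeats h c b r T \<and> repeats h c p r T' \<and> repeats h c d r T' \<and>
    card T = 3 \<and> card T' = 3 \<and> T \<inter> T' = {r} \<and> T \<union> T' = K"

lemma card_3_sets:
  assumes "card (A \<inter> B) \<ge> 3" "card A \<le> 3" "card B \<le> 3" "finite A" "finite B"
  shows "A = B \<and> card A = 3"
proof -
  have "A \<inter> B = A" by (rule card_seteq) (use assms in auto)
  moreover have "A \<inter> B = B" by (rule card_seteq) (use assms in auto)
  ultimately have "A = B" by auto
  then show ?thesis using assms by simp
qed

text \<open>The two colours outside \<open>T\<close> can only be blocked by \<open>p\<close> and
  \<open>d\<close>, which also see the colour \<open>r\<close> repeated at \<open>a\<close>. These
  three are all that they can see, so \<open>T'\<close> is forced and meets \<open>T\<close> only in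
  \<open>r\<close>; every repeated colour lies in both sets and hence is \<open>r\<close>.\<close>

lemma rigid_half:
  assumes hole: "hole h c" and pat: "two_pairs h c a b p d"
    and cab: "card (cols h c a \<inter> cols h c b) \<ge> 3"
  shows "\<exists>r T T'. rigid h c a b p d r T T'"
proof -
  note pats = pat two_pairs_flip[OF pat] two_pairs_swap[OF pat]
    two_pairs_flip[OF two_pairs_swap[OF pat]]
  note le = pats[THEN two_pairs_card_cols[OF hole]]
  define T where "T = cols h c a"
  define T' where "T' = cols h c p"
  have T: "cols h c a = T" "cols h c b = T" "card T = 3"
    using card_3_sets[OF cab le(1,2)] finite_cols by (auto simp: T_def)
  have fT: "finite T" "T \<subseteq> K" using finite_cols cols_subset[OF hole] by (auto simp: T_def)
  have cov: "K - T \<subseteq> cols h c p \<inter> cols h c d"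
  proof
    fix i assume i: "i \<in> K - T"
    obtain y z where yz: "y \<in> N h" "z \<in> N h" "y \<noteq> z" "c y = c z" "i \<in> cols h c y" "i \<in> cols h c z"
      using hole_blocked[OF hole] i by blast
    then have "{y, z} = {a, b} \<or> {y, z} = {p, d}" using two_pairsD[OF pat] by simp
    then show "i \<in> cols h c p \<inter> cols h c d" using yz(5,6) i T by (auto simp: doubleton_eq_iff)
  qed
  have cKT: "card (K - T) = 2" using fT T(3) K by (simp add: card_Diff_subset)
  obtain r where r: "r \<in> T" "r \<in> cols h c p" "r \<in> cols h c d" "repeats h c a r T"
    using two_pairs_repeats[OF hole pats(1)] T by auto
  obtain s where s: "s \<in> T" "s \<in> cols h c p" "s \<in> cols h c d" "repeats h c b s T"
    using two_pairs_repeats[OF hole pats(2)] T by auto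
  have ins: "insert r (K - T) \<subseteq> cols h c p \<inter> cols h c d" using cov r by auto
  have c3: "card (insert r (K - T)) = 3" using cKT r K by simp
  have pd: "cols h c p = cols h c d \<and> card (cols h c p) = 3"
    using card_mono[OF _ ins] c3 le(3,4) finite_cols by (intro card_3_sets) auto
  then have T': "cols h c p = T'" "cols h c d = T'" "card T' = 3" by (auto simp: T'_def)
  have T'eq: "T' = insert r (K - T)"
    using card_seteq[of T' "insert r (K - T)"] ins T' c3 finite_cols[of h c p] by auto
  then have rs: "s = r" using s r T' by auto
  obtain u where u: "u \<in> T'" "u \<in> T" "repeats h c p u T'"
    using two_pairs_repeats[OF hole pats(3)] T T' by auto
  obtain v where v: "v \<in> T'" "v \<in> T" "repeats h c d v T'"
    using two_pairs_repeats[OF hole pats(4)] T T' by auto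
  have "u = r" "v = r" using u v T'eq by auto
  moreover have "T \<inter> T' = {r}" "T \<union> T' = K" using T'eq r fT by auto
  ultimately have "rigid h c a b p d r T T'"
    unfolding rigid_def using r s u v rs T T' by auto
  then show ?thesis by blast
qed

lemma rigid_swap: "rigid h c p d a b r T' T \<Longrightarrow> rigid h c a b p d r T T'"
  unfolding rigid_def by (auto simp: Un_commute Int_commute)

text \<open>The common colours of \<open>a\<close>, \<open>b\<close> and those of \<open>p\<close>,
  \<open>d\<close> cover all five, so one of the two sets has at least three elements.\<close>

lemma two_pairs_rigid:
  assumes hole: "hole h c" and pat: "two_pairs h c a b p d"
  shows "\<exists>r T T'. rigid h c a b p d r T T'"
proof -
  have "K \<subseteq> (cols h c a \<inter> cols h c b) \<union> (cols h c p \<inter> cols h c d)"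
  proof
    fix i assume i: "i \<in> K"
    obtain y z where yz: "y \<in> N h" "z \<in> N h" "y \<noteq> z" "c y = c z" "i \<in> cols h c y" "i \<in> cols h c z"
      using hole_blocked[OF hole i] by blast
    then have "{y, z} = {a, b} \<or> {y, z} = {p, d}" using two_pairsD[OF pat] by simp
    then show "i \<in> (cols h c a \<inter> cols h c b) \<union> (cols h c p \<inter> cols h c d)"
      using yz(5,6) by (auto simp: doubleton_eq_iff)
  qed
  then have "5 \<le> card ((cols h c a \<inter> cols h c b) \<union> (cols h c p \<inter> cols h c d))"
    using card_mono[of "(cols h c a \<inter> cols h c b) \<union> (cols h c p \<inter> cols h c d)" K] finite_cols K
    by simp
  also have "\<dots> \<le> card (cols h c a \<inter> cols h c b) + card (cols h c p \<inter> cols h c d)"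
    by (rule card_Un_le)
  finally have "card (cols h c a \<inter> cols h c b) \<ge> 3 \<or> card (cols h c p \<inter> cols h c d) \<ge> 3" by linarith
  then show ?thesis
    using rigid_half[OF hole pat] rigid_half[OF hole two_pairs_swap[OF pat]] rigid_swap by blast
qed

lemma two_pairs_after_move:
  assumes "a \<in> N h" "x \<in> N a - {h}" "y \<in> N a - {h}" "x \<noteq> y" "c x = c y"
    and xy: "\<And>v w. \<lbrakk>v \<in> N a - {h}; w \<in> N a - {h}; v \<noteq> w; c v = c w\<rbrakk> \<Longrightarrow> {v, w} = {x, y}"
    and w: "w \<in> N a - {h}" "w \<notin> {x, y}"
  shows "two_pairs a (c(h := c w)) h w x y"
proof -
  have ne: "c w \<noteq> c x" using xy[of w x] w assms(2) by auto
  have "{v, z} = {h, w} \<or> {v, z} = {x, y}"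
    if v: "v \<in> N a" "z \<in> N a" "v \<noteq> z" "(c(h := c w)) v = (c(h := c w)) z" for v z
  proof -
    consider "v = h" | "z = h" | "v \<noteq> h" "z \<noteq> h" by blast
    then show ?thesis
    proof cases
      case 1
      then have "z = w \<or> {z, w} = {x, y}" using v w xy[of z w] by auto
      then show ?thesis using 1 w by auto
    next
      case 2
      then have "v = w \<or> {v, w} = {x, y}" using v w xy[of v w] by auto
      then show ?thesis using 2 w by auto
    next
      case 3
      then show ?thesis using v xy[of v z] by auto
    qed
  qed
  moreover have "h \<in> N a" "h \<noteq> w" using assms(1) N_sym w(1) by blast+
  ultimately show ?thesis
    unfolding two_pairs_def using assms(2-5) w ne by (intro conjI ballI impI) simp_all
qed

text \<open>Moving the hole to \<open>a\<close> creates two pairs there as well, and their rigidity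
  describes \<open>h\<close>: it has a fifth neighbour \<open>e\<close>, and the agreeing neighbours
  \<open>x\<close>, \<open>y\<close> of \<open>a\<close> do not see \<open>c e\<close>. So nothing
  stops \<open>a\<close> from taking that colour in the original colouring.\<close>

lemma two_pairs_fifth:
  assumes hole: "hole h c" and pat: "two_pairs h c a b p d"
  shows "\<exists>e\<in>N h. e \<notin> {a, b, p, d} \<and> hole h (c(a := c e))"
proof -
  have a: "a \<in> N h" using pat by (simp add: two_pairs_def)
  obtain r T T' where rig: "rigid h c a b p d r T T'" using two_pairs_rigid[OF hole pat] by blast
  have cT: "cols h c a = T" "card T = 3" "T \<inter> T' = {r}" "cols h c p = T'" "repeats h c a r T"
    using rig by (auto simp: rigid_def repeats_def)
  have c3: "card (cols h c a) = 3" using cT by simp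
  obtain x y where x: "x \<in> N a - {h}" "y \<in> N a - {h}" "x \<noteq> y" "c x = c y"
    and xy0: "\<forall>v\<in>N a - {h}. \<forall>w\<in>N a - {h}. v \<noteq> w \<longrightarrow> c v = c w \<longrightarrow> {v, w} = {x, y}"
    using three_cols_if_not_rainbow[OF a c3 two_pairs_not_rainbow[OF hole pat]]
    by (elim bexE conjE) (rule that)
  have xy: "{v, w} = {x, y}" if "v \<in> N a - {h}" "w \<in> N a - {h}" "v \<noteq> w" "c v = c w" for v w
    using xy0 that by blast
  have cx: "c x = r" using cT(5) x unfolding repeats_def by blast
  \<comment> \<open>A colour of \<open>T\<close> other than \<open>r\<close> is outside
    \<open>T'\<close>, so \<open>p\<close> and \<open>d\<close> cannot block it for
    \<open>h\<close>.\<close>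
  have "\<not> T \<subseteq> {r}" using cT(2) card_mono[of "{r}" T] by auto
  then obtain q where q: "q \<in> T" "q \<noteq> r" by blast
  then obtain w where w: "w \<in> N a - {h}" "c w = q" using cT(1) by (auto simp: cols_def)
  then have w': "w \<notin> {x, y}" using q cx x by auto
  let ?c = "c(h := c w)"
  have h': "hole a ?c"
  proof (rule hole_move[OF hole a hole_range[OF hole]])
    fix v z assume v: "v \<in> N h - {a}" "z \<in> N h - {a}" "v \<noteq> z" "c v = c z"
      "c w \<in> cols h c v" "c w \<in> cols h c z"
    then have "{v, z} = {p, d}" using two_pairs_avoid[OF pat] by simp
    then have "c w \<in> cols h c p" using v by (auto simp: doubleton_eq_iff)
    then show False using cT q w by auto
  qed
  have pat': "two_pairs a ?c h w x y" using two_pairs_after_move[OF a x xy w(1) w'] .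
  obtain r1 T1 T1' where rig': "rigid a ?c h w x y r1 T1 T1'" using two_pairs_rigid[OF h' pat'] by blast
  have nh: "p \<noteq> h" "d \<noteq> h" using pat N_irrefl by (auto simp: two_pairs_def)
  have pd: "p \<in> N h - {a}" "d \<in> N h - {a}" "p \<noteq> d" "c p = c d"
    using pat by (auto simp: two_pairs_def)
  \<comment> \<open>Around \<open>h\<close> the vertices \<open>p\<close> and \<open>d\<close>
    agree, which identifies the repeated colour \<open>r1\<close> as \<open>c p\<close>.\<close>
  have "repeats a ?c h r1 T1" using rig' by (simp add: rigid_def)
  then have *: "card (N h - {a}) = 4" "cols a ?c h = T1" "?c p = r1"
    using pd nh unfolding repeats_def by (blast, blast, auto)
  have "\<not> N h - {a} \<subseteq> {b, p, d}"
    using card_mono[of "{b, p, d}" "N h - {a}"] *(1) by (auto simp: card_insert_if split: if_splits)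
  then obtain e where e: "e \<in> N h" "e \<notin> {a, b, p, d}" by blast
  have eh: "e \<noteq> h" using e N_irrefl by auto
  have "c e \<noteq> c p" using pat e unfolding two_pairs_def by (auto simp: doubleton_eq_iff)
  moreover have "c e \<in> T1" using *(2) e eh by (force simp: cols_def)
  ultimately have ce: "c e \<notin> T1'" using rig' *(3) nh by (auto simp: rigid_def)
  have T1': "cols a ?c x = T1'" "cols a ?c y = T1'" using rig' by (auto simp: rigid_def repeats_def)
  have "hole h (c(a := c e))"
  proof (rule hole_recolour[OF hole _ hole_range[OF hole]])
    show "a \<noteq> h" using a N_irrefl by auto
    fix v z assume v: "v \<in> N a - {h}" "z \<in> N a - {h}" "v \<noteq> z" "c v = c z"
      "c e \<in> c ` (N v - {h, a})" "c e \<in> c ` (N z - {h, a})"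
    then have "{v, z} = {x, y}" using xy by blast
    then have "c e \<in> c ` (N x - {h, a})" using v by (auto simp: doubleton_eq_iff)
    then have "c e \<in> cols a ?c x" by (force simp: cols_def)
    then show False using ce T1' by simp
  qed
  then show ?thesis using e by blast
qed

text \<open>\<open>e\<close> is the partner of \<open>a\<close> in \<open>?c1\<close> and of
  \<open>p\<close> in \<open>?c2\<close>, so by rigidity it sees \<open>T\<close> in the former and
  \<open>T'\<close> in the latter. The two colourings differ only at \<open>a\<close> and
  \<open>p\<close>.\<close>

lemma no_two_pairs:
  assumes hole: "hole h c" and pat: "two_pairs h c a b p d"
  shows False
proof -
  note P = pat[unfolded two_pairs_def]
  obtain e where e: "e \<in> N h" "e \<notin> {a, b, p, d}" "hole h (c(a := c e))"
    using two_pairs_fifth[OF hole pat] by blast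
  obtain e' where e': "e' \<in> N h" "e' \<notin> {p, d, a, b}" "hole h (c(p := c e'))"
    using two_pairs_fifth[OF hole two_pairs_swap[OF pat]] by blast
  have dist: "a \<notin> {b, p, d}" "b \<notin> {p, d}" "p \<noteq> d" using P by auto
  have "card {a, b, p, d, e} = 5" using dist e(2) by auto
  then have N: "N h = {a, b, p, d, e}"
    using card_seteq[of "N h" "{a, b, p, d, e}"] P e(1) card_N[of h] finite_N by simp
  then have ee: "e' = e" using e' by auto
  have ce: "c e \<noteq> c a" "c e \<noteq> c p" using P e by (auto simp: doubleton_eq_iff)
  let ?c1 = "c(a := c e)" and ?c2 = "c(p := c e)"
  have col: "c b = c a" "c d = c p" "c a \<noteq> c p" "c p \<noteq> c a" using P by auto
  have dist': "e \<noteq> a" "e \<noteq> b" "e \<noteq> p" "e \<noteq> d" "a \<noteq> e" "a \<noteq> b" "a \<noteq> p" "a \<noteq> d"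
    "b \<noteq> a" "b \<noteq> p" "b \<noteq> d" "p \<noteq> a" "p \<noteq> b" "p \<noteq> d" "d \<noteq> a" "d \<noteq> b" "d \<noteq> p" "p \<noteq> e"
    using e(2) dist by blast+
  have p1: "two_pairs h ?c1 a e p d"
    unfolding two_pairs_def N by (simp add: col ce ce[symmetric] dist' insert_commute)
  have p2: "two_pairs h ?c2 a b p e"
    unfolding two_pairs_def N by (simp add: col ce ce[symmetric] dist' insert_commute)
  obtain r T T' where R: "rigid h c a b p d r T T'" using two_pairs_rigid[OF hole pat] by blast
  obtain r1 T1 T1' where R1: "rigid h ?c1 a e p d r1 T1 T1'" using two_pairs_rigid[OF e(3) p1] by blast
  obtain r2 T2 T2' where R2: "rigid h ?c2 a b p e r2 T2 T2'"
    using two_pairs_rigid[OF _ p2] e'(3) ee by blast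
  have "cols h ?c1 a = cols h c a" "cols h ?c2 p = cols h c p"
    using N_irrefl by (auto simp: cols_def intro!: image_cong)
  then have T: "cols h ?c1 e = T" "cols h ?c2 e = T'"
    using R R1 R2 by (auto simp: rigid_def repeats_def)
  have "card (T - T') = 2" "card (T' - T) = 2"
    using R card_Diff_subset_Int[of T T'] card_Diff_subset_Int[of T' T]
    by (auto simp: rigid_def Int_commute)
  \<comment> \<open>The vertices \<open>a\<close>, \<open>p\<close> have colours \<open>c e\<close>,
    \<open>c p\<close> in \<open>?c1\<close> and \<open>c a\<close>, \<open>c e\<close> in
    \<open>?c2\<close>. By cardinality both inclusions are equalities, which puts \<open>c e\<close>
    into two disjoint sets.\<close>
  moreover have "T - T' \<subseteq> {c e, c p}" "T' - T \<subseteq> {c e, c a}"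
    using T[symmetric] dist by (auto simp: cols_def split: if_splits)
  moreover have "card {c e, c p} = 2" "card {c e, c a} = 2" using ce by simp_all
  ultimately have "T - T' = {c e, c p}" "T' - T = {c e, c a}"
    using card_seteq[of "{c e, c p}" "T - T'"] card_seteq[of "{c e, c a}" "T' - T"] by simp_all
  then show False by blast
qed

subsection \<open>The remaining distributions of colours\<close>

text \<open>Otherwise \<open>h\<close> could take colour \<open>i\<close> and the hole could move to
  \<open>a\<close>. Since \<open>a\<close> sees three colours, at most one pair agreed around it, so
  now either at most three vertices are involved in agreements or there are two separate pairs; both
  are excluded.\<close>

lemma blocked_if_three_cols:
  assumes hole: "hole h c" and a: "a \<in> N h" and c3: "card (cols h c a) \<ge> 3" and i: "i \<in> K"
  shows "\<exists>y\<in>N h - {a}. \<exists>z\<in>N h - {a}. y \<noteq> z \<and> c y = c z \<and> i \<in> cols h c y \<and> i \<in> cols h c z"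
proof (rule ccontr)
  assume neg: "\<not> ?thesis"
  let ?c = "c(h := i)" and ?D = "N a - {h}"
  have h': "hole a ?c" by (rule hole_move[OF hole a i]) (use neg in blast)
  have ha: "h \<in> N a" using a N_sym by blast
  have fin: "finite ?D" using finite_N by simp
  show False
  proof (cases "inj_on c ?D")
    case True
    let ?W = "{w \<in> ?D. c w = i}"
    have "card ?W \<le> 1"
      using True fin by (auto simp: card_le_Suc0_iff_eq inj_on_def)
    then have "card (insert h ?W) \<le> 3" using fin by (simp add: card_insert_if)
    moreover have "pairs_in a ?c (insert h ?W)"
      unfolding pairs_in_def using True by (auto simp: inj_on_def split: if_splits)
    ultimately show False
      using no_pairs_in_three[OF h', of "insert h ?W"] ha fin by auto
  next
    case False
    have c3': "card (cols h c a) = 3"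
      using c3 card_cols_if_not_rainbow[OF a False] by simp
    obtain x y where x: "x \<in> ?D" "y \<in> ?D" "x \<noteq> y" "c x = c y"
      and xy0: "\<forall>v\<in>?D. \<forall>w\<in>?D. v \<noteq> w \<longrightarrow> c v = c w \<longrightarrow> {v, w} = {x, y}"
      using three_cols_if_not_rainbow[OF a c3' False]
      by (elim bexE conjE) (rule that)
    have xy: "{v, w} = {x, y}" if "v \<in> ?D" "w \<in> ?D" "v \<noteq> w" "c v = c w" for v w
      using xy0 that by blast
    show False
    proof (cases "\<exists>w\<in>?D. c w = i \<and> w \<notin> {x, y}")
      case True
      then obtain w where w: "w \<in> ?D" "w \<notin> {x, y}" "c w = i" by blast
      have "two_pairs a (c(h := c w)) h w x y"
        by (rule two_pairs_after_move[OF a x xy w(1,2)])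
      then show False using no_two_pairs[OF h'] w(3) by simp
    next
      case no: False
      have "pairs_in a ?c {h, x, y}"
        unfolding pairs_in_def
      proof (intro ballI impI)
        fix v w assume v: "v \<in> N a" "w \<in> N a" "v \<noteq> w" "?c v = ?c w"
        show "v \<in> {h, x, y} \<and> w \<in> {h, x, y}"
        proof (cases "v = h \<or> w = h")
          case True
          then have "v = h \<and> w \<in> {x, y} \<or> w = h \<and> v \<in> {x, y}"
            using v no by (metis Diff_iff fun_upd_apply singletonD)
          then show ?thesis by blast
        next
          case False
          then have "{v, w} = {x, y}" using v xy[of v w] by simp
          then show ?thesis by auto
        qed
      qed
      moreover have "card {h, x, y} \<le> 3" by (simp add: card_insert_if)
      ultimately show False using no_pairs_in_three[OF h', of "{h, x, y}"] x ha by auto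
    qed
  qed
qed

text \<open>If a vertex of \<open>A\<close> sees three colours, the blocking pairs can avoid it and
  have only 3 * 3 incidences; if none does, there are only 4 * 2. This covers every distribution
  with a colour occurring exactly once around \<open>h\<close>.\<close>

lemma no_pairs_in_four:
  assumes hole: "hole h c" and A: "finite A" "card A \<le> 4" "A \<subseteq> N h" "pairs_in h c A"
  shows False
proof -
  have small: "card (A - {a}) \<le> 3" if "a \<in> A" for a using that A by simp
  have nr: "\<not> inj_on c (N a - {h})" if a: "a \<in> A" for a
  proof
    assume "inj_on c (N a - {h})"
    then obtain c' where "hole h c'" "pairs_in h c' (A - {a})"
      using isolate_pairs_in[OF hole _ _ A(4)] a A by blast
    then show False using no_pairs_in_three[of h c' "A - {a}"] small[OF a] A by auto
  qed
  have le3: "card (cols h c a) \<le> 3" if "a \<in> A" for a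
    using card_cols_if_not_rainbow nr that A by blast
  have le2: "card (cols h c a) \<le> 2" if a: "a \<in> A" for a
  proof (rule ccontr)
    assume "\<not> ?thesis"
    then have c3: "card (cols h c a) \<ge> 3" by simp
    have "10 \<le> card (A - {a}) * 3"
    proof (rule cols_count)
      fix i assume "i \<in> K"
      then obtain y z where "y \<in> N h - {a}" "z \<in> N h - {a}" "y \<noteq> z" "c y = c z"
        "i \<in> cols h c y" "i \<in> cols h c z"
        using blocked_if_three_cols[OF hole _ c3] a A by blast
      then show "\<exists>y\<in>A - {a}. \<exists>z\<in>A - {a}. y \<noteq> z \<and> i \<in> cols h c y \<and> i \<in> cols h c z"
        using A(4) unfolding pairs_in_def by blast
    qed (use A le3 in auto)
    then show False using small[OF a] by simp
  qed
  have "10 \<le> card A * 2"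
    using cols_count[OF A(1) pairs_in_blocked[OF hole A(4)] le2] by blast
  then show False using A by simp
qed

section \<open>The pattern 3+2\<close>

definition triple_and_pair :: "'a \<Rightarrow> ('a \<Rightarrow> nat) \<Rightarrow> 'a \<Rightarrow> 'a \<Rightarrow> 'a \<Rightarrow> 'a \<Rightarrow> 'a \<Rightarrow> bool" where
  "triple_and_pair h c a b g d e \<longleftrightarrow>
    N h = {a, b, g, d, e} \<and> distinct [a, b, g, d, e] \<and>
    c a = c b \<and> c a = c g \<and> c d = c e \<and> c a \<noteq> c d"

lemma two_cover_eq:
  assumes "finite A" "finite B" "finite P" "finite Q"
    and "card A \<le> 3" "card B \<le> 3" "card P \<le> 2" "card Q \<le> 2"
    and "card L = 5" "L \<subseteq> (A \<inter> B) \<union> (P \<inter> Q)"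
  shows "card A = 3 \<and> A = B \<and> P = Q \<and> card P = 2 \<and> A \<inter> P = {}"
proof -
  have AB: "card (A \<inter> B) \<le> card A" and PQ: "card (P \<inter> Q) \<le> card P"
    using assms(1,3) by (simp_all add: card_mono)
  have "finite ((A \<inter> B) \<union> (P \<inter> Q))" using assms(1,3) by simp
  from card_mono[OF this assms(10)]
  have U: "5 \<le> card ((A \<inter> B) \<union> (P \<inter> Q))" using assms(9) by simp
  have I: "card (A \<inter> B) + card (P \<inter> Q) =
      card ((A \<inter> B) \<union> (P \<inter> Q)) + card ((A \<inter> B) \<inter> (P \<inter> Q))"
    using assms(1,3) by (intro card_Un_Int) simp_all
  have c: "card (A \<inter> B) = 3" "card (P \<inter> Q) = 2" "card ((A \<inter> B) \<inter> (P \<inter> Q)) = 0"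
    using AB PQ U I assms(5,7) by linarith+
  have "A \<inter> B = A" using card_seteq[of A "A \<inter> B"] assms(1,5) c(1) by simp
  moreover have "A \<inter> B = B" using card_seteq[of B "A \<inter> B"] assms(2,6) c(1) by simp
  moreover have "P \<inter> Q = P" using card_seteq[of P "P \<inter> Q"] assms(3,7) c(2) by simp
  moreover have "P \<inter> Q = Q" using card_seteq[of Q "P \<inter> Q"] assms(4,8) c(2) by simp
  moreover have "(A \<inter> B) \<inter> (P \<inter> Q) = {}" using c(3) assms(1) by simp
  ultimately show ?thesis using c(1,2) by simp
qed

text \<open>Isolating \<open>a\<close> would confine all agreements to the at most four other
  neighbours of \<open>h\<close>.\<close>

lemma not_rainbow:
  assumes hole: "hole h c" and a: "a \<in> N h" shows "\<not> inj_on c (N a - {h})"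
proof
  assume inj: "inj_on c (N a - {h})"
  have "pairs_in h c (N h)" by (simp add: pairs_in_def)
  then obtain c' where c': "hole h c'" "pairs_in h c' (N h - {a})"
    using isolate_pairs_in[OF hole a inj] by blast
  have "card (N h - {a}) \<le> 4" using card_N[of h] a finite_N by (simp add: card_Diff_singleton)
  then show False using no_pairs_in_four[OF c'(1) _ _ _ c'(2)] finite_N by auto
qed

lemma card_cols_le_3: "hole h c \<Longrightarrow> a \<in> N h \<Longrightarrow> card (cols h c a) \<le> 3"
  using card_cols_if_not_rainbow not_rainbow by blast

lemma triple_and_pair_pairs:
  assumes "triple_and_pair h c a b g d e" "v \<in> N h" "w \<in> N h" "v \<noteq> w" "c v = c w"
  shows "v \<in> {a, b, g} \<and> w \<in> {a, b, g} \<or> v \<in> {d, e} \<and> w \<in> {d, e}"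
proof -
  have N: "N h = {a, b, g, d, e}" and ne: "c a \<noteq> c d"
    and C: "\<forall>x\<in>{a, b, g}. c x = c a" "\<forall>x\<in>{d, e}. c x = c d"
    using assms(1) unfolding triple_and_pair_def by simp_all
  have "v \<in> {a, b, g} \<or> v \<in> {d, e}" "w \<in> {a, b, g} \<or> w \<in> {d, e}"
    using assms(2,3) N by blast+
  then show ?thesis using C ne assms(5) by metis
qed

text \<open>The pair blocks at most two colours, and the triple has no incidence to spare for the
  rest. Equality in the counts makes \<open>d\<close> and \<open>e\<close> see the same two colours
  and keeps these away from the triple.\<close>

lemma triple_and_pair_structure:
  assumes hole: "hole h c" and pat: "triple_and_pair h c a b g d e"
  shows "cols h c d = cols h c e" "card (cols h c d) = 2"
    "\<And>x. x \<in> {a, b, g} \<Longrightarrow> cols h c x \<inter> cols h c d = {}"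
    "cols h c a \<subseteq> cols h c b \<union> cols h c g"
proof -
  let ?C = "cols h c"
  note P = pat[unfolded triple_and_pair_def]
  have "N h = {a, b, g, d, e}" using P by (rule conjunct1)
  then have mem: "a \<in> N h" "b \<in> N h" "g \<in> N h" "d \<in> N h" "e \<in> N h" by simp_all
  note le = mem[THEN card_cols_le_3[OF hole]]
  have blk: "(\<exists>y\<in>{a, b, g}. \<exists>z\<in>{a, b, g}. y \<noteq> z \<and> i \<in> ?C y \<and> i \<in> ?C z) \<or> i \<in> ?C d \<inter> ?C e"
    if i: "i \<in> K" for i
  proof -
    obtain y z where yz: "y \<in> N h" "z \<in> N h" "y \<noteq> z" "c y = c z" "i \<in> ?C y" "i \<in> ?C z"
      using hole_blocked[OF hole i] by blast
    show ?thesis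
    proof (cases "y \<in> {a, b, g} \<and> z \<in> {a, b, g}")
      case False
      then have "y \<in> {d, e} \<and> z \<in> {d, e}" using triple_and_pair_pairs[OF pat yz(1-4)] by blast
      then show ?thesis using yz(3,5,6) by auto
    qed (use yz in blast)
  qed
  \<comment> \<open>If \<open>d\<close> or \<open>e\<close> saw three colours, the blocking pairs
    could avoid it, and the triple alone would need 10 incidences with at most 9 available.\<close>
  have de2: "card (?C x) \<le> 2" if x: "x \<in> {d, e}" for x
  proof (rule ccontr)
    assume "\<not> ?thesis"
    then have c3: "card (?C x) \<ge> 3" by simp
    have xN: "x \<in> N h" using x mem by blast
    have "10 \<le> card {a, b, g} * 3"
    proof (rule cols_count)
      fix i assume "i \<in> K"
      then obtain y z where yz: "y \<in> N h - {x}" "z \<in> N h - {x}" "y \<noteq> z" "c y = c z"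
        "i \<in> ?C y" "i \<in> ?C z"
        using blocked_if_three_cols[OF hole xN c3] by blast
      then have "y \<in> {a, b, g} \<and> z \<in> {a, b, g}"
        using triple_and_pair_pairs[OF pat, of y z] x by auto
      then show "\<exists>y\<in>{a, b, g}. \<exists>z\<in>{a, b, g}. y \<noteq> z \<and> i \<in> ?C y \<and> i \<in> ?C z" using yz by blast
    qed (use le in auto)
    moreover have "card {a, b, g} \<le> 3" by (simp add: card_insert_if)
    ultimately show False by simp
  qed
  \<comment> \<open>A member of the triple seeing three colours can be avoided; the other two and
    the pair then cover five colours as exactly 3 + 2.\<close>
  have three: "card (?C y) = 3 \<and> ?C y = ?C z \<and> ?C d = ?C e \<and> card (?C d) = 2 \<and> ?C y \<inter> ?C d = {}"
    if x: "{a, b, g} = {x, y, z}" and c3: "card (?C x) \<ge> 3" for x y z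
  proof (rule two_cover_eq)
    have "{a, b, g} \<subseteq> N h" using mem(1-3) by simp
    then have xN: "x \<in> N h" "y \<in> N h" "z \<in> N h" unfolding x by simp_all
    show "K \<subseteq> (?C y \<inter> ?C z) \<union> (?C d \<inter> ?C e)"
    proof
      fix i assume "i \<in> K"
      then obtain v w where vw: "v \<in> N h - {x}" "w \<in> N h - {x}" "v \<noteq> w" "c v = c w"
        "i \<in> ?C v" "i \<in> ?C w"
        using blocked_if_three_cols[OF hole xN(1) c3] by blast
      consider "v \<in> {y, z}" "w \<in> {y, z}" | "v \<in> {d, e}" "w \<in> {d, e}"
        using triple_and_pair_pairs[OF pat, of v w] vw(1-4) unfolding x by blast
      then show "i \<in> (?C y \<inter> ?C z) \<union> (?C d \<inter> ?C e)" using vw(3,5,6) by cases auto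
    qed
    show "card (?C y) \<le> 3" "card (?C z) \<le> 3" using card_cols_le_3[OF hole] xN by blast+
  qed (use de2 K finite_cols in auto)
  have main: "?C d = ?C e \<and> card (?C d) = 2 \<and> (\<forall>x\<in>{a, b, g}. ?C x \<inter> ?C d = {})"
  proof (cases "\<exists>x\<in>{a, b, g}. card (?C x) \<ge> 3")
    case True
    have p: "{a, b, g} = {b, a, g}" "{a, b, g} = {g, a, b}" by blast+
    from True consider "card (?C a) \<ge> 3" | "card (?C b) \<ge> 3" | "card (?C g) \<ge> 3" by blast
    \<comment> \<open>One such vertex forces three colours on the other two, so omitting
      \<open>a\<close> and then \<open>b\<close> reaches the whole triple.\<close>
    then have ab: "card (?C a) \<ge> 3" "card (?C b) \<ge> 3"
      using three[OF refl] three[OF p(1)] three[OF p(2)] by (cases; fastforce)+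
    show ?thesis
      using three[OF refl ab(1)] three[OF p(1) ab(2)] by (elim conjE) (intro conjI ballI, auto)
  next
    case False
    then have le2: "card (?C x) \<le> 2" if "x \<in> {a, b, g}" for x using that by fastforce
    let ?L = "K - ?C d \<inter> ?C e"
    have cnt: "2 * card ?L \<le> (\<Sum>x\<in>{a, b, g}. card (?C x \<inter> ?L))"
    proof (rule double_count)
      fix i assume "i \<in> ?L"
      then show "\<exists>y\<in>{a, b, g}. \<exists>z\<in>{a, b, g}. y \<noteq> z \<and> i \<in> ?C y \<and> i \<in> ?C z"
        using blk[of i] by blast
    qed (use K in simp_all)
    have leL: "card (?C x \<inter> ?L) \<le> 2" if "x \<in> {a, b, g}" for x
      using le2[OF that] card_mono[OF finite_cols, of "?C x \<inter> ?L" h c x] by simp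
    have abg: "card {a, b, g} = 3" using P by auto
    have "(\<Sum>x\<in>{a, b, g}. card (?C x \<inter> ?L)) \<le> (\<Sum>x\<in>{a, b, g}. 2)"
      by (rule sum_mono) (rule leL)
    then have L3: "card ?L \<le> 3" using cnt abg by simp
    have sub: "?C d \<inter> ?C e \<subseteq> K" using cols_subset[OF hole] by blast
    have cL: "card ?L = 5 - card (?C d \<inter> ?C e)"
      using card_Diff_subset[OF _ sub] K finite_cols by simp
    then have ge: "card (?C d \<inter> ?C e) \<ge> 2" using L3 by simp
    have "?C d \<inter> ?C e = ?C d" by (rule card_seteq) (use ge de2[of d] finite_cols in auto)
    moreover have "?C d \<inter> ?C e = ?C e" by (rule card_seteq) (use ge de2[of e] finite_cols in auto)
    ultimately have de: "?C d = ?C e" "?C d \<inter> ?C e = ?C d" by auto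
    have cd: "card (?C d) = 2" using ge de(2) de2[of d] by simp
    then have cL3: "card ?L = 3" using cL de(2) by simp
    \<comment> \<open>A shared colour would be an incidence outside \<open>?L\<close>, leaving the
      triple with fewer than the 2 * 3 needed on \<open>?L\<close>.\<close>
    have "?C x \<inter> ?C d = {}" if x: "x \<in> {a, b, g}" for x
    proof (rule ccontr)
      assume "?C x \<inter> ?C d \<noteq> {}"
      then have "?C x \<inter> ?L \<subset> ?C x" using de by blast
      then have "card (?C x \<inter> ?L) < card (?C x)" by (intro psubset_card_mono finite_cols)
      then have "card (?C x \<inter> ?L) < 2" using le2[OF x] by simp
      then have "(\<Sum>x\<in>{a, b, g}. card (?C x \<inter> ?L)) < (\<Sum>x\<in>{a, b, g}. 2)"
        using x leL by (intro sum_strict_mono_ex1) blast+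
      then show False using cnt cL3 abg by simp
    qed
    then show ?thesis using de cd by blast
  qed
  then show "?C d = ?C e" "card (?C d) = 2" "\<And>x. x \<in> {a, b, g} \<Longrightarrow> ?C x \<inter> ?C d = {}" by blast+
  show "?C a \<subseteq> ?C b \<union> ?C g"
  proof
    fix i assume i: "i \<in> ?C a"
    then have "i \<in> K" "i \<notin> ?C d" using main cols_subset[OF hole] by blast+
    then obtain y z where "y \<in> {a, b, g}" "z \<in> {a, b, g}" "y \<noteq> z" "i \<in> ?C y" "i \<in> ?C z"
      using blk by blast
    then show "i \<in> ?C b \<union> ?C g" by auto
  qed
qed

text \<open>If \<open>k\<close> occurred at most once, agreements around \<open>d\<close> would
  involve only \<open>h\<close> and the vertices coloured \<open>j\<close>, at most four in all
  because some vertex has colour \<open>k\<close>.\<close>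

lemma two_cols_after_move:
  assumes d: "d \<in> N h" and cols: "cols h c d = {j, k}" "j \<noteq> k" and hole: "hole d (c(h := j))"
  shows "card {x \<in> N d - {h}. c x = k} \<ge> 2"
proof (rule ccontr)
  let ?D = "N d - {h}" and ?c = "c(h := j)"
  let ?A = "insert h {x \<in> ?D. c x = j}"
  assume "\<not> ?thesis"
  then have le: "card {x \<in> ?D. c x = k} \<le> Suc 0" by simp
  have fin: "finite ?D" using finite_N by simp
  obtain x where x: "x \<in> ?D" "c x = k" using cols(1) unfolding cols_def by (metis imageE insertCI)
  have "card {x \<in> ?D. c x = j} < card ?D"
  proof (rule psubset_card_mono[OF fin])
    have "x \<notin> {x \<in> ?D. c x = j}" using x(2) cols(2) by simp
    then show "{x \<in> ?D. c x = j} \<subset> ?D" using x(1) by blast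
  qed
  then have "card ?A \<le> 4" using card_N_minus[OF d] fin by (simp add: card_insert_if)
  moreover have "pairs_in d ?c ?A"
    unfolding pairs_in_def
  proof (intro ballI impI)
    fix v w assume v: "v \<in> N d" "w \<in> N d" "v \<noteq> w" "?c v = ?c w"
    show "v \<in> ?A \<and> w \<in> ?A"
    proof (cases "v = h \<or> w = h")
      case False
      then have D: "v \<in> ?D" "w \<in> ?D" "c v = c w" using v by simp_all
      have "c v \<noteq> k"
      proof
        assume "c v = k"
        then have "v = w" using le D fin by (simp add: card_le_Suc0_iff_eq)
        then show False using v(3) by simp
      qed
      moreover have "c v \<in> {j, k}" using cols(1) D(1) unfolding cols_def by blast
      ultimately show ?thesis using D by simp
    qed (use v in auto)
  qed
  moreover have "?A \<subseteq> N d" using d N_sym by auto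
  moreover have "finite ?A" using fin by simp
  ultimately show False using no_pairs_in_four[OF hole, of ?A] by simp
qed

text \<open>Both colours occur at least twice on at most four vertices, hence exactly twice. The
  colour given to \<open>h\<close> decides which class becomes the triple.\<close>

lemma triple_and_pair_after_move:
  assumes d: "d \<in> N h" and cols: "cols h c d = {s, t}" "s \<noteq> t"
    and holes: "hole d (c(h := s))" "hole d (c(h := t))"
  shows "\<exists>u v x y. triple_and_pair d (c(h := s)) h u v x y \<and> triple_and_pair d (c(h := t)) h x y u v"
proof -
  let ?D = "N d - {h}"
  let ?S = "{x \<in> ?D. c x = s}" and ?T = "{x \<in> ?D. c x = t}"
  have fin: "finite ?S" "finite ?T" using finite_N by simp_all
  have "cols h c d = {t, s}" using cols(1) by (simp add: insert_commute)
  then have ge: "card ?S \<ge> 2" "card ?T \<ge> 2"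
    using two_cols_after_move[OF d _ _ holes(2)] two_cols_after_move[OF d _ _ holes(1)] cols
    by simp_all
  have D: "?D = ?S \<union> ?T" using cols(1) unfolding cols_def by blast
  have disj: "?S \<inter> ?T = {}" using cols(2) by auto
  have "card ?D = card (?S \<union> ?T)" by (rule arg_cong[OF D])
  also have "\<dots> = card ?S + card ?T" by (rule card_Un_disjoint[OF fin disj])
  finally have "card ?S = 2" "card ?T = 2" using ge card_N_minus[OF d] by linarith+
  then obtain u v x y where uv: "?S = {u, v}" "u \<noteq> v" and xy: "?T = {x, y}" "x \<noteq> y"
    unfolding card_2_iff by blast
  have "u \<in> ?S" "v \<in> ?S" "x \<in> ?T" "y \<in> ?T" using uv xy by blast+
  then have cl: "c u = s" "c v = s" "c x = t" "c y = t" "h \<noteq> u" "h \<noteq> v" "h \<noteq> x" "h \<noteq> y" by auto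
  then have ne: "u \<noteq> x" "u \<noteq> y" "v \<noteq> x" "v \<noteq> y" using cols(2) by auto
  have "h \<in> N d" using d N_sym by blast
  then have N: "N d = {h, u, v, x, y}" using D uv xy by blast
  then have "N d = {h, x, y, u, v}" by blast
  then show ?thesis
    unfolding triple_and_pair_def using N cl ne uv(2) xy(2) cols(2)
    by (intro exI[of _ u] exI[of _ v] exI[of _ x] exI[of _ y]) simp
qed

text \<open>The hole can move to \<open>d\<close> with \<open>h\<close> coloured \<open>s\<close> or
  \<open>t\<close>, and triple and pair around \<open>d\<close> then trade places. A colour around
  \<open>h\<close> is seen by \<open>u\<close> or \<open>v\<close> in one pattern and by neither in
  the other, although only the colour of \<open>h\<close> has changed.\<close>

lemma no_triple_and_pair:
  assumes hole: "hole h c" and pat: "triple_and_pair h c a b g d e"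
  shows False
proof -
  note S = triple_and_pair_structure[OF hole pat]
  have NN: "N h = {a, b, g, d, e}" using pat unfolding triple_and_pair_def by (elim conjE)
  have ne: "a \<noteq> d" "e \<noteq> d" "c a \<noteq> c e" using pat unfolding triple_and_pair_def by auto
  have mem: "a \<in> N h" "d \<in> N h" "e \<in> N h" using NN by simp_all
  obtain s t where st: "cols h c d = {s, t}" "s \<noteq> t" using S(2) unfolding card_2_iff by blast
  have mv: "hole d (c(h := j))" if j: "j \<in> {s, t}" for j
  proof (rule hole_move[OF hole mem(2)])
    show "j \<in> K" using j st(1) cols_subset[OF hole] by blast
    fix v w assume v: "v \<in> N h - {d}" "w \<in> N h - {d}" "v \<noteq> w" "c v = c w"
      "j \<in> cols h c v" "j \<in> cols h c w"
    then have "v \<in> {a, b, g}" using triple_and_pair_pairs[OF pat, of v w] by blast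
    then show False using S(3)[of v] v(5) j st(1) by blast
  qed
  let ?c1 = "c(h := s)" and ?c2 = "c(h := t)"
  obtain u v x y where uv: "triple_and_pair d ?c1 h u v x y" "triple_and_pair d ?c2 h x y u v"
    using triple_and_pair_after_move[OF mem(2) st] mv by blast
  note S1 = triple_and_pair_structure[OF mv uv(1)] and S2 = triple_and_pair_structure[OF mv uv(2)]
  have all_s: "j = s" if j: "j \<in> {c a, c e}" for j
  proof -
    have hN: "cols d (c(h := i)) h = c ` (N h - {d})" for i
      unfolding cols_def using N_irrefl by (intro image_cong) auto
    have jh: "j \<in> c ` (N h - {d})" using j mem ne by blast
    then have "j \<in> cols d ?c1 u \<union> cols d ?c1 v" using S1(4) hN by auto
    then obtain w where w: "w \<in> {u, v}" "j \<in> cols d ?c1 w" by blast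
    have "j \<notin> cols d ?c2 w" using S2(1) S2(3)[of h] w(1) jh hN by auto
    \<comment> \<open>\<open>w\<close> sees \<open>j\<close> when \<open>h\<close> has colour
      \<open>s\<close> and no longer when it has colour \<open>t\<close>.\<close>
    then show "j = s" using w(2) by (auto simp: cols_def split: if_splits)
  qed
  show False using all_s[of "c a"] all_s[of "c e"] ne(3) by simp
qed

section \<open>The pattern 5\<close>

text \<open>If \<open>a\<close> sees exactly three colours and cannot be recoloured, then one of its two equally coloured
  neighbours \<open>x\<close> has neighbours of five distinct colours. Recolouring \<open>x\<close> makes the colours around
  \<open>a\<close> distinct.\<close>
lemma monochromatic_card_cols:
  assumes hole: "hole h c" and mono: "\<And>x. x \<in> N h \<Longrightarrow> c x = \<alpha>" and ex: "a \<in> N h"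
  shows "card (cols h c a) \<le> 2"
proof (rule ccontr)
  assume "\<not> ?thesis"
  then have c3: "card (cols h c a) = 3" using card_cols_le_3[OF hole ex] by simp
  obtain x y where x: "x \<in> N a - {h}" "y \<in> N a - {h}" "x \<noteq> y" "c x = c y"
    and xy0: "\<forall>v\<in>N a - {h}. \<forall>w\<in>N a - {h}. v \<noteq> w \<longrightarrow> c v = c w \<longrightarrow> {v, w} = {x, y}"
    using three_cols_if_not_rainbow[OF ex c3 not_rainbow[OF hole ex]]
    by (elim bexE conjE) (rule that)
  have ne: "a \<noteq> h" "x \<noteq> h" using ex x N_irrefl by auto
  \<comment> \<open>Otherwise \<open>a\<close> could take colour \<open>i\<close> and be alone with
    it, leaving at most four agreeing neighbours. The remaining colour \<alpha> is contributed to
    \<open>x\<close> by \<open>a\<close> itself.\<close>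
  have "i \<in> c ` (N x - {h, a})" if i: "i \<in> K" "i \<noteq> \<alpha>" for i
  proof (rule ccontr)
    assume n: "\<not> ?thesis"
    have "hole h (c(a := i))"
    proof (rule hole_recolour[OF hole ne(1) i(1)])
      fix v w assume v: "v \<in> N a - {h}" "w \<in> N a - {h}" "v \<noteq> w" "c v = c w"
        "i \<in> c ` (N v - {h, a})" "i \<in> c ` (N w - {h, a})"
      then have "{v, w} = {x, y}" using xy0 by blast
      then have "v = x \<or> w = x" by blast
      then show False using n v(5,6) by blast
    qed
    moreover have "pairs_in h (c(a := i)) (N h - {a})"
      unfolding pairs_in_def using mono i(2) by (auto split: if_splits)
    moreover have "card (N h - {a}) \<le> 4"
      using card_N[of h] ex finite_N by (simp add: card_Diff_singleton)
    ultimately show False using no_pairs_in_four[of h "c(a := i)" "N h - {a}"] finite_N by simp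
  qed
  moreover have "\<alpha> \<in> c ` (N x - {h})"
    using mono[OF ex] ne(1) x(1) N_sym by blast
  ultimately have "K \<subseteq> c ` (N x - {h})" by blast
  then have "5 \<le> card (c ` (N x - {h}))" using card_mono[of "c ` (N x - {h})" K] finite_N K by simp
  moreover have "card (N x - {h}) \<le> 5"
    using card_N[of x] card_mono[of "N x" "N x - {h}"] finite_N by (meson Diff_subset le_trans)
  ultimately have inj: "inj_on c (N x - {h})"
    using finite_N card_image_le[of "N x - {h}" c] by (intro eq_card_imp_inj_on) auto
  have "\<not> K \<subseteq> cols h c a" using c3 K card_mono[OF finite_cols, of K h c a] by auto
  then obtain i where i: "i \<in> K" "i \<notin> cols h c a" by blast
  have h': "hole h (c(x := i))"
    by (rule hole_recolour[OF hole ne(2) i(1)]) (use inj in \<open>auto dest: inj_onD\<close>)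
  have "inj_on (c(x := i)) (N a - {h})"
  proof (rule inj_onI)
    fix v w assume v: "v \<in> N a - {h}" "w \<in> N a - {h}" "(c(x := i)) v = (c(x := i)) w"
    have i': "c z \<noteq> i" if "z \<in> N a - {h}" for z using i(2) that by (auto simp: cols_def)
    show "v = w"
    proof (rule ccontr)
      assume vw: "v \<noteq> w"
      then have nx: "v \<noteq> x" "w \<noteq> x" using v i' by (auto split: if_splits)
      then have "{v, w} = {x, y}" using xy0 v vw by auto
      then show False using nx by blast
    qed
  qed
  then show False using not_rainbow[OF h' ex] by blast
qed

text \<open>Five neighbours with at most two colours each must supply ten incidences, so
  \<open>a\<close> sees exactly two colours and no colour is seen three times. Hence neither colour
  of \<open>a\<close> is blocked by other neighbours, and both moves to \<open>a\<close> are
  possible.\<close>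

lemma no_monochromatic:
  assumes hole: "hole h c" and mono: "\<And>x. x \<in> N h \<Longrightarrow> c x = \<alpha>" and a: "a \<in> N h"
  shows False
proof -
  let ?C = "cols h c"
  have le2: "card (?C x) \<le> 2" if "x \<in> N h" for x
    using monochromatic_card_cols[OF hole mono that] .
  have cnt: "2 * card L \<le> (\<Sum>x\<in>N h. card (?C x \<inter> L))" if "L \<subseteq> K" for L
  proof (rule double_count)
    show "\<exists>x\<in>N h. \<exists>y\<in>N h. x \<noteq> y \<and> i \<in> ?C x \<and> i \<in> ?C y" if "i \<in> L" for i
      using hole_blocked[OF hole, of i] \<open>L \<subseteq> K\<close> that by blast
    show "finite L" using K that finite_subset by blast
  qed (rule finite_N)
  have leL: "card (?C x \<inter> L) \<le> 2" if "x \<in> N h" for x L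
    using le2[OF that] card_mono[OF finite_cols, of "?C x \<inter> L" h c x] by simp
  have "(\<Sum>x\<in>N h. card (?C x \<inter> K)) = card (?C a \<inter> K) + (\<Sum>x\<in>N h - {a}. card (?C x \<inter> K))"
    by (rule sum.remove[OF finite_N a])
  also have "(\<Sum>x\<in>N h - {a}. card (?C x \<inter> K)) \<le> (\<Sum>x\<in>N h - {a}. 2)"
    by (rule sum_mono) (use leL in blast)
  also have "\<dots> \<le> 8" using card_N[of h] a finite_N by (simp add: card_Diff_singleton)
  finally have "2 \<le> card (?C a \<inter> K)" using cnt[of K] K by simp
  moreover have "?C a \<inter> K = ?C a" using cols_subset[OF hole] by blast
  ultimately have "card (?C a) = 2" using le2[OF a] by simp
  then obtain s t where st: "?C a = {s, t}" "s \<noteq> t" unfolding card_2_iff by blast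
  have mv: "hole a (c(h := j))" if j: "j \<in> {s, t}" for j
  proof (rule hole_move[OF hole a])
    show jK: "j \<in> K" using j st(1) cols_subset[OF hole] by blast
    fix y z assume y: "y \<in> N h - {a}" "z \<in> N h - {a}" "y \<noteq> z" "c y = c z" "j \<in> ?C y" "j \<in> ?C z"
    \<comment> \<open>If \<open>a\<close>, \<open>y\<close>, \<open>z\<close> all saw
      \<open>j\<close>, the other four colours would have at most 2 * 2 + 3 * 1 = 7 incidences
      instead of 8.\<close>
    let ?L = "K - {j}" and ?A = "{a, y, z}"
    have le1: "card (?C x \<inter> ?L) \<le> 1" if x: "x \<in> ?A" for x
    proof -
      have "j \<in> ?C x" "x \<in> N h" using x y j st(1) a by auto
      moreover have "?C x \<inter> ?L \<subseteq> ?C x - {j}" by blast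
      ultimately show ?thesis
        using le2[of x] card_mono[of "?C x - {j}" "?C x \<inter> ?L"] finite_cols[of h c x] by simp
    qed
    have A: "?A \<subseteq> N h" "card ?A = 3" using y(1-3) a by auto
    have "(\<Sum>x\<in>N h. card (?C x \<inter> ?L)) =
        (\<Sum>x\<in>N h - ?A. card (?C x \<inter> ?L)) + (\<Sum>x\<in>?A. card (?C x \<inter> ?L))"
      by (rule sum.subset_diff[OF A(1) finite_N])
    also have "\<dots> \<le> (\<Sum>x\<in>N h - ?A. 2) + (\<Sum>x\<in>?A. 1)"
      by (intro add_mono sum_mono) (use leL le1 in blast)+
    also have "\<dots> \<le> 7" using card_N[of h] A card_Diff_subset[of ?A "N h"] by simp
    finally show False using cnt[of ?L] jK K by (simp add: card_Diff_singleton)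
  qed
  obtain u v x y where "triple_and_pair a (c(h := s)) h u v x y"
    using triple_and_pair_after_move[OF a st] mv by blast
  then show False using no_triple_and_pair mv by blast
qed

section \<open>Combining the patterns\<close>

lemma no_three_two_classes:
  assumes hole: "hole h c" and N: "N h = {x \<in> N h. c x = \<alpha>} \<union> {x \<in> N h. c x = \<beta>}" and ne: "\<alpha> \<noteq> \<beta>"
    and c: "card {x \<in> N h. c x = \<alpha>} = 3" "card {x \<in> N h. c x = \<beta>} = 2"
  shows False
proof -
  obtain a b g where X: "{x \<in> N h. c x = \<alpha>} = {a, b, g}" "a \<noteq> b" "b \<noteq> g" "a \<noteq> g"
    using c(1) unfolding card_3_iff by blast
  obtain d e where Z: "{x \<in> N h. c x = \<beta>} = {d, e}" "d \<noteq> e"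
    using c(2) unfolding card_2_iff by blast
  have "a \<in> {a, b, g}" "b \<in> {a, b, g}" "g \<in> {a, b, g}" "d \<in> {d, e}" "e \<in> {d, e}" by simp_all
  then have cl: "c a = \<alpha>" "c b = \<alpha>" "c g = \<alpha>" "c d = \<beta>" "c e = \<beta>"
    unfolding X(1)[symmetric] Z(1)[symmetric] by simp_all
  then have "a \<notin> {d, e}" "b \<notin> {d, e}" "g \<notin> {d, e}" using ne by auto
  moreover have "N h = {a, b, g} \<union> {d, e}" using N unfolding X(1) Z(1) .
  then have "N h = {a, b, g, d, e}" by (simp only: Un_insert_left Un_empty_left)
  ultimately have "triple_and_pair h c a b g d e"
    unfolding triple_and_pair_def using cl ne X Z by simp
  then show False using no_triple_and_pair[OF hole] by blast
qed

text \<open>A missing fifth neighbour or a colour occurring once around \<open>h\<close> leaves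
  agreements among at most four vertices. So five neighbours fall into classes of size at least two:
  5 or 3 + 2.\<close>

lemma no_hole: "\<not> hole h c"
proof
  assume hole: "hole h c"
  define X where "X \<alpha> = {x \<in> N h. c x = \<alpha>}" for \<alpha>
  have fX: "finite (X \<alpha>)" for \<alpha> using finite_N by (simp add: X_def)
  have ge2: "card (X (c a)) \<ge> 2" if a: "a \<in> N h" for a
  proof (rule ccontr)
    assume "\<not> ?thesis"
    then have 1: "card (X (c a)) \<le> Suc 0" by simp
    have "pairs_in h c (N h - {a})"
      unfolding pairs_in_def
    proof (intro ballI impI)
      fix y z assume yz: "y \<in> N h" "z \<in> N h" "y \<noteq> z" "c y = c z"
      have "c y \<noteq> c a"
      proof
        assume "c y = c a"
        then have "y \<in> X (c a)" "z \<in> X (c a)" using yz by (simp_all add: X_def)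
        then show False using 1 fX yz(3) by (simp add: card_le_Suc0_iff_eq)
      qed
      then show "y \<in> N h - {a} \<and> z \<in> N h - {a}" using yz by auto
    qed
    moreover have "card (N h - {a}) \<le> 4"
      using card_N[of h] a finite_N by (simp add: card_Diff_singleton)
    ultimately show False using no_pairs_in_four[OF hole, of "N h - {a}"] finite_N by simp
  qed
  have c5: "card (N h) = 5"
  proof (rule ccontr)
    assume "\<not> ?thesis"
    then have "card (N h) \<le> 4" using card_N[of h] by simp
    then show False using no_pairs_in_four[OF hole, of "N h"] finite_N by (simp add: pairs_in_def)
  qed
  then obtain a where a: "a \<in> N h" by fastforce
  show False
  proof (cases "\<forall>x\<in>N h. c x = c a")
    case True
    then show False using no_monochromatic[OF hole _ a] by blast
  next
    case False
    then obtain d where d: "d \<in> N h" "c d \<noteq> c a" by blast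
    have disj: "X \<alpha> \<inter> X \<beta> = {}" if "\<alpha> \<noteq> \<beta>" for \<alpha> \<beta> using that by (auto simp: X_def)
    have sub: "X \<alpha> \<subseteq> N h" for \<alpha> by (auto simp: X_def)
    have two: "card (X (c a) \<union> X (c d)) = card (X (c a)) + card (X (c d))"
      using card_Un_disjoint[OF fX fX disj] d(2) by metis
    have N: "N h = X (c a) \<union> X (c d)"
    proof (rule ccontr)
      assume "N h \<noteq> X (c a) \<union> X (c d)"
      then obtain f where f: "f \<in> N h" "f \<notin> X (c a) \<union> X (c d)" using sub by blast
      then have "c f \<noteq> c a" "c f \<noteq> c d" by (auto simp: X_def)
      then have "(X (c a) \<union> X (c d)) \<inter> X (c f) = {}" using disj by blast
      then have "card (X (c a) \<union> X (c d) \<union> X (c f)) = card (X (c a)) + card (X (c d)) + card (X (c f))"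
        using card_Un_disjoint[of "X (c a) \<union> X (c d)" "X (c f)"] fX two by simp
      moreover have "card (X (c a) \<union> X (c d) \<union> X (c f)) \<le> card (N h)"
        using sub by (intro card_mono finite_N) blast
      ultimately show False using ge2[OF a] ge2[OF d(1)] ge2[OF f(1)] c5 by simp
    qed
    then have "card (X (c a)) + card (X (c d)) = 5" using two c5 by simp
    then consider "card (X (c a)) = 3" "card (X (c d)) = 2" | "card (X (c d)) = 3" "card (X (c a)) = 2"
      using ge2[OF a] ge2[OF d(1)] by linarith
    then show False
    proof cases
      case 1
      show False
        by (rule no_three_two_classes[OF hole N[unfolded X_def] d(2)[symmetric] 1[unfolded X_def]])
    next
      case 2
      have N': "N h = X (c d) \<union> X (c a)" using N by blast
      show False
        by (rule no_three_two_classes[OF hole N'[unfolded X_def] d(2) 2[unfolded X_def]])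
    qed
  qed
qed

end

subsection \<open>Colouring the whole graph\<close>

lemma acyclic_graph_mono: "acyclic_graph E \<Longrightarrow> F \<subseteq> E \<Longrightarrow> acyclic_graph F"
  unfolding acyclic_graph_def is_cycle_def by blast

lemma card_nbrs_le_degree:
  assumes "simple_graph V E"
  shows "card (nbrs E u) \<le> degree E u"
proof -
  have "finite E" using assms finite_subset[of E "Pow V"] by (auto simp: simple_graph_def)
  moreover have "inj_on (\<lambda>w. {u, w}) (nbrs E u)" by (auto simp: inj_on_def doubleton_eq_iff)
  ultimately show ?thesis
    unfolding degree_def by (intro card_inj_on_le) (auto simp: nbrs_def)
qed

lemma acyclic_D1_colouring_if_valid:
  assumes "simple_graph V E" "range c \<subseteq> {1..k}" "valid E c"
  shows "acyclic_D1_colouring V E k c"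
proof -
  have "induced_edges E {v \<in> V. c v = i} \<subseteq> bichromatic_edges E c i i" for i
  proof
    fix e assume e: "e \<in> induced_edges E {v \<in> V. c v = i}"
    then have "card e = 2" using assms(1) by (auto simp: induced_edges_def simple_graph_def)
    then obtain u v where "e = {u, v}" unfolding card_2_iff by blast
    then show "e \<in> bichromatic_edges E c i i"
      using e by (auto simp: induced_edges_def bichromatic_edges_def)
  qed
  then show ?thesis
    using assms(2,3) unfolding acyclic_D1_colouring_def valid_def
    by (meson acyclic_graph_mono rangeI subsetD)
qed

text \<open>If adding \<open>h\<close> destroyed colourability, the graph on
  \<open>insert h W\<close> would satisfy \<open>uncolourable\<close>, and the colouring of
  \<open>W\<close> would be one with hole \<open>h\<close>.\<close>

lemma ex_valid_induced:
  assumes G: "simple_graph V E" and deg: "\<forall>v\<in>V. degree E v \<le> 5" and "finite W"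
  shows "\<exists>c. range c \<subseteq> {1..5} \<and> valid {e \<in> E. e \<subseteq> W} c"
  using \<open>finite W\<close>
proof (induction W)
  case empty
  have E: "{e \<in> E. e \<subseteq> {}} = {}" using G by (auto simp: simple_graph_def)
  have "valid {} (\<lambda>_. 1)"
    by (fastforce simp: valid_def bichromatic_edges_def acyclic_graph_def is_cycle_def)
  then show ?case unfolding E by (intro exI[of _ "\<lambda>_. 1"]) simp
next
  case (insert h W)
  then obtain c where c: "range c \<subseteq> {1..5}" "valid {e \<in> E. e \<subseteq> W} c" by blast
  let ?F = "{e \<in> E. e \<subseteq> insert h W}"
  show ?case
  proof (rule ccontr)
    assume neg: "\<not> ?case"
    have sub: "nbrs ?F u \<subseteq> nbrs E u" "nbrs E u \<subseteq> V" for u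
      using G by (auto simp: nbrs_def simple_graph_def)
    have fin: "finite (nbrs E u)" for u
      using finite_subset[OF sub(2)] G unfolding simple_graph_def by blast
    have le: "card (nbrs E u) \<le> 5" for u
    proof (cases "u \<in> V")
      case True
      then show ?thesis using card_nbrs_le_degree[OF G, of u] deg le_trans by blast
    next
      case False
      then have "nbrs E u = {}" using G by (auto simp: nbrs_def simple_graph_def)
      then show ?thesis by simp
    qed
    have U: "uncolourable ?F"
    proof
      show "{u} \<notin> ?F" for u using G by (force simp: simple_graph_def)
      show "finite (nbrs ?F u)" for u using sub(1) fin finite_subset by blast
      show "card (nbrs ?F u) \<le> 5" for u using card_mono[OF fin sub(1)] le le_trans by blast
      show False if "range c \<subseteq> {1..5}" "valid ?F c" for c using neg that by blast
    qed
    interpret uncolourable ?F "nbrs ?F" "{1..5}" by (rule U) simp_all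
    have "hole h c"
      unfolding hole_def using c by (auto intro: valid_mono)
    then show False using no_hole by blast
  qed
qed

theorem mainTheorem3:
  fixes V :: "'a set" and E :: "'a set set"
  assumes "simple_graph V E"
    and "\<forall>v\<in>V. degree E v \<le> 5"
  shows "\<exists>c. acyclic_D1_colouring V E 5 c"
proof -
  have "finite V" "{e \<in> E. e \<subseteq> V} = E" using assms(1) by (auto simp: simple_graph_def)
  then show ?thesis
    using ex_valid_induced[OF assms] acyclic_D1_colouring_if_valid[OF assms(1)] by metis
qed

end
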